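(* Left propagation of linear extension: let $(X,\phi)$ be a persistence poset indexed by a linearly ordered set $I$. Assume that $I$ is converse well-founded and that there exists a maximal index $i$ such that $X_j=\varnothing$ for any $j>i$. Then $(X,\phi)$ has a linear extension.
   Context: Let $I$ be a linearly ordered set, viewed as a category; converse well-founded means that every non-empty subset of $I$ has a maximal element. A persistence poset $(X,\phi)$ is a functor from $I$ to the category of posets and order-preserving maps, with components $X_i$ and structure maps $\phi_{ij}: X_i\to X_j$ for $i\leqslant j$. Convention: if $X_i\ne\varnothing$ and $X_j=\varnothing$ for some $i<j$, so that no function $X_i\to X_j$ exists, one formally sets $\phi_{ij}=\bot$ and ignores it in all conditions involving structure maps. An extension of a persistence poset $(X,\phi)$ is a family of partial orders, one on the underlying set of each $X_i$, each containing the given order of $X_i$, such that all the structure maps $\phi_{ij}$ remain order-preserving with respect to the new orders. The extension is called linear if the order on every component is a total order. *)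

theory Defs
  imports Main "HOL-Library.FuncSet"
begin

definition converse_well_founded :: "'i::linorder set \<Rightarrow> bool" where
  "converse_well_founded I \<longleftrightarrow>
     (\<forall>S\<subseteq>I. S \<noteq> {} \<longrightarrow> (\<exists>m\<in>S. \<forall>x\<in>S. \<not> m < x))"

lemma converse_well_founded_iff_wfp_on:
  "converse_well_founded I \<longleftrightarrow> wfp_on I (>)"
proof -
  have "(\<exists>m\<in>S. \<forall>x\<in>S. \<not> m < x) \<longleftrightarrow> (\<exists>m\<in>S. \<forall>x. m < x \<longrightarrow> x \<notin> S)" for S :: "'a set"
    by auto
  then show ?thesis
    unfolding converse_well_founded_def wfp_on_iff_ex_minimal by simp
qed

(* There is a function A \<rightarrow> B unless A is nonempty and B is empty.  In that exceptional case the
   structure map is formally \<bottom>; here the value of \<phi> i j is then arbitrary, and every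
   condition mentioning such a \<phi> i j is guarded by has_map. *)
definition has_map :: "'a set \<Rightarrow> 'a set \<Rightarrow> bool" where
  "has_map A B \<longleftrightarrow> (B = {} \<longrightarrow> A = {})"

definition order_preserving :: "'a set \<Rightarrow> 'a rel \<Rightarrow> 'a rel \<Rightarrow> ('a \<Rightarrow> 'a) \<Rightarrow> bool" where
  "order_preserving A r s f \<longleftrightarrow> monotone_on A (\<lambda>x y. (x, y) \<in> r) (\<lambda>x y. (x, y) \<in> s) f"

(* The component at i is the set X i ordered by the relation le i.  All components live in one
   type 'a; they need not be disjoint.  Functions are compared only on X i. *)
definition persistence_poset ::
    "'i::linorder set \<Rightarrow> ('i \<Rightarrow> 'a set) \<Rightarrow> ('i \<Rightarrow> 'a rel) \<Rightarrow> ('i \<Rightarrow> 'i \<Rightarrow> 'a \<Rightarrow> 'a) \<Rightarrow> bool" where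
  "persistence_poset I X le \<phi> \<longleftrightarrow>
     (\<forall>i\<in>I. partial_order_on (X i) (le i)) \<and>
     (\<forall>i\<in>I. \<forall>j\<in>I. i \<le> j \<and> has_map (X i) (X j) \<longrightarrow>
        \<phi> i j \<in> X i \<rightarrow> X j \<and> order_preserving (X i) (le i) (le j) (\<phi> i j)) \<and>
     (\<forall>i\<in>I. \<forall>x\<in>X i. \<phi> i i x = x) \<and>
     (\<forall>i\<in>I. \<forall>j\<in>I. \<forall>k\<in>I. i \<le> j \<and> j \<le> k \<and> has_map (X i) (X j) \<and> has_map (X j) (X k) \<longrightarrow>
        (\<forall>x\<in>X i. \<phi> j k (\<phi> i j x) = \<phi> i k x))"

definition extension_of ::
    "'i::linorder set \<Rightarrow> ('i \<Rightarrow> 'a set) \<Rightarrow> ('i \<Rightarrow> 'a rel) \<Rightarrow> ('i \<Rightarrow> 'i \<Rightarrow> 'a \<Rightarrow> 'a) \<Rightarrow>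
     ('i \<Rightarrow> 'a rel) \<Rightarrow> bool" where
  "extension_of I X le \<phi> L \<longleftrightarrow>
     (\<forall>i\<in>I. partial_order_on (X i) (L i) \<and> le i \<subseteq> L i) \<and>
     (\<forall>i\<in>I. \<forall>j\<in>I. i \<le> j \<and> has_map (X i) (X j) \<longrightarrow>
        order_preserving (X i) (L i) (L j) (\<phi> i j))"

definition linear_extension_of ::
    "'i::linorder set \<Rightarrow> ('i \<Rightarrow> 'a set) \<Rightarrow> ('i \<Rightarrow> 'a rel) \<Rightarrow> ('i \<Rightarrow> 'i \<Rightarrow> 'a \<Rightarrow> 'a) \<Rightarrow>
     ('i \<Rightarrow> 'a rel) \<Rightarrow> bool" where
  "linear_extension_of I X le \<phi> L \<longleftrightarrow>
     extension_of I X le \<phi> L \<and> (\<forall>i\<in>I. linear_order_on (X i) (L i))"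

end

theory Submission
  imports Defs
begin

text \<open>Choose a linear extension \<open>S i\<close> of each component separately. For two distinct elements
  of \<open>X i\<close>, converse well-foundedness yields a last index \<open>m\<close> (with \<open>X m\<close> nonempty) at which their
  images differ; order them as their images in \<open>S m\<close>. This last index is unchanged by
  the structure maps, as long as these keep the two elements apart, and that makes the structure
  maps monotone.\<close>

text \<open>The added pairs are those that transitivity forces once \<open>x\<close> is put below
  \<open>y\<close>. Chaining two of them, or finding the reverse of one in \<open>r\<close>, would
  give \<open>(y, x) \<in> r\<close>; hence one round of additions is already transitive and creates
  no cycle.\<close>

lemma partial_order_on_insert_pair:
  assumes "partial_order_on A r" "x \<in> A" "y \<in> A" "(y, x) \<notin> r"
  shows "partial_order_on A (r \<union> {(a, b). (a, x) \<in> r \<and> (y, b) \<in> r})"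
proof -
  note po = partial_order_onD[OF assms(1)]
  have "trans (r \<union> {(a, b). (a, x) \<in> r \<and> (y, b) \<in> r})"
    using \<open>trans r\<close> assms(4) unfolding trans_def by blast
  moreover have "antisym (r \<union> {(a, b). (a, x) \<in> r \<and> (y, b) \<in> r})"
    using \<open>trans r\<close> \<open>antisym r\<close> assms(4) unfolding trans_def antisym_def by blast
  ultimately show ?thesis
    using po(1,4) unfolding partial_order_on_def preorder_on_def refl_on_def by blast
qed

lemma partial_order_on_Union_chain:
  assumes "C \<noteq> {}" "subset.chain {s. partial_order_on A s} C"
  shows "partial_order_on A (\<Union>C)"
proof -
  have ch: "chain\<^sub>\<subseteq> C" and po: "\<forall>s\<in>C. partial_order_on A s"
    using assms(2) by (auto simp: subset_chain_def chain_subset_def)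
  have "trans (\<Union>C)" "antisym (\<Union>C)"
    using chain_subset_trans_Union[OF ch] chain_subset_antisym_Union[OF ch] po
    by (auto simp: partial_order_on_def preorder_on_def)
  moreover have "\<Union>C \<subseteq> A \<times> A" "refl_on A (\<Union>C)"
    using po assms(1) unfolding partial_order_on_def preorder_on_def refl_on_def by blast+
  ultimately show ?thesis
    unfolding partial_order_on_def preorder_on_def by blast
qed

text \<open>Zorn's lemma gives a maximal partial order containing \<open>r\<close>. It is total
  because an incomparable pair could still be added to it.\<close>

theorem szpilrajn:
  assumes "partial_order_on A r"
  shows "\<exists>s. linear_order_on A s \<and> r \<subseteq> s"
proof -
  let ?E = "{s. partial_order_on A s \<and> r \<subseteq> s}"
  have "\<exists>m\<in>?E. \<forall>s\<in>?E. m \<subseteq> s \<longrightarrow> s = m"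
  proof (rule subset_Zorn_nonempty)
    show "?E \<noteq> {}" using assms by blast
  next
    fix C assume C: "C \<noteq> {}" "subset.chain ?E C"
    then have "subset.chain {s. partial_order_on A s} C"
      by (auto simp: subset_chain_def)
    moreover have "r \<subseteq> \<Union>C"
      using C by (force simp: subset_chain_def)
    ultimately show "\<Union>C \<in> ?E"
      using partial_order_on_Union_chain C(1) by blast
  qed
  then obtain m where m: "partial_order_on A m" "r \<subseteq> m"
    and max: "\<And>s. partial_order_on A s \<Longrightarrow> m \<subseteq> s \<Longrightarrow> s = m"
    by (metis (mono_tags, lifting) mem_Collect_eq subset_trans)
  have "total_on A m"
  proof (rule total_onI, rule ccontr)
    fix x y assume xy: "x \<in> A" "y \<in> A" "\<not> ((x, y) \<in> m \<or> (y, x) \<in> m)"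
    \<comment> \<open>By maximality the enlarged order is \<open>m\<close> again, yet reflexivity at
      \<open>x\<close> and \<open>y\<close> puts \<open>(x, y)\<close> among the added
      pairs.\<close>
    have "m \<union> {(a, b). (a, x) \<in> m \<and> (y, b) \<in> m} = m"
      using partial_order_on_insert_pair[OF m(1)] xy by (intro max) auto
    moreover have "(x, x) \<in> m" "(y, y) \<in> m"
      using partial_order_onD(1)[OF m(1)] xy by (auto simp: refl_on_def)
    ultimately show False using xy by blast
  qed
  then show ?thesis
    using m unfolding linear_order_on_def by blast
qed

text \<open>Indices with empty component are skipped, since the structure maps into them are junk.\<close>

definition last_split ::
    "'i::linorder set \<Rightarrow> ('i \<Rightarrow> 'a set) \<Rightarrow> ('i \<Rightarrow> 'i \<Rightarrow> 'a \<Rightarrow> 'a) \<Rightarrow> 'i \<Rightarrow> 'a \<Rightarrow> 'a \<Rightarrow> 'i \<Rightarrow> bool" where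
  "last_split I X \<phi> i x y m \<longleftrightarrow>
     m \<in> I \<and> X m \<noteq> {} \<and> i \<le> m \<and> \<phi> i m x \<noteq> \<phi> i m y \<and>
     (\<forall>k\<in>I. X k \<noteq> {} \<and> m < k \<longrightarrow> \<phi> i k x = \<phi> i k y)"

text \<open>The disjunct \<open>x = y\<close> supplies reflexivity: an element never separates from
  itself, so it has no splitting index.\<close>

definition last_split_order ::
    "'i::linorder set \<Rightarrow> ('i \<Rightarrow> 'a set) \<Rightarrow> ('i \<Rightarrow> 'i \<Rightarrow> 'a \<Rightarrow> 'a) \<Rightarrow> ('i \<Rightarrow> 'a rel) \<Rightarrow> 'i \<Rightarrow> 'a rel" where
  "last_split_order I X \<phi> S i = {(x, y). x \<in> X i \<and> y \<in> X i \<and>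
     (x = y \<or> (\<exists>m. last_split I X \<phi> i x y m \<and> (\<phi> i m x, \<phi> i m y) \<in> S m))}"

lemma last_split_commute: "last_split I X \<phi> i x y m \<longleftrightarrow> last_split I X \<phi> i y x m"
  unfolding last_split_def by metis

lemma last_split_unique:
  "last_split I X \<phi> i x y m \<Longrightarrow> last_split I X \<phi> i x y n \<Longrightarrow> m = n"
  unfolding last_split_def by (metis linorder_neq_iff)

text \<open>Beyond the larger index all three images agree; at that index exactly one of the two
  pairs is still apart, so \<open>x\<close> and \<open>z\<close> differ there. If
  \<open>m = n\<close>, both pairs are apart at the common index, and \<open>x\<close> and
  \<open>z\<close> might already have merged.\<close>

lemma last_split_trans:
  assumes "last_split I X \<phi> i x y m" "last_split I X \<phi> i y z n" "m \<noteq> n"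
  shows "last_split I X \<phi> i x z (max m n)"
proof (cases "m < n")
  case True
  then show ?thesis
    using assms(1,2) by (simp add: last_split_def) (metis less_trans)
next
  case False
  then have "n < m" using assms(3) by simp
  then show ?thesis
    using assms(1,2) by (simp add: last_split_def) (metis less_trans)
qed

lemma trans_last_split_order:
  assumes S: "\<And>j. j \<in> I \<Longrightarrow> trans (S j) \<and> antisym (S j)"
  shows "trans (last_split_order I X \<phi> S i)"
proof (rule transI)
  fix x y z
  assume xy: "(x, y) \<in> last_split_order I X \<phi> S i" and yz: "(y, z) \<in> last_split_order I X \<phi> S i"
  show "(x, z) \<in> last_split_order I X \<phi> S i"
  proof (cases "x = y \<or> y = z")
    case True
    then show ?thesis using xy yz by auto
  next
    case False
    have X: "x \<in> X i" "z \<in> X i"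
      using xy yz by (auto simp: last_split_order_def)
    from False xy yz obtain m n
      where m: "last_split I X \<phi> i x y m" "(\<phi> i m x, \<phi> i m y) \<in> S m"
        and n: "last_split I X \<phi> i y z n" "(\<phi> i n y, \<phi> i n z) \<in> S n"
      by (auto simp: last_split_order_def)
    have "\<exists>k. last_split I X \<phi> i x z k \<and> (\<phi> i k x, \<phi> i k z) \<in> S k"
    proof (cases "m = n")
      case True
      have I: "m \<in> I" using m(1) by (simp add: last_split_def)
      have "(\<phi> i m x, \<phi> i m z) \<in> S m"
        using S[OF I] m(2) n(2) True by (blast dest: transD)
      \<comment> \<open>If these images coincided, the image of \<open>y\<close> would lie between
        them in \<open>S m\<close> and, by antisymmetry, coincide with them too.\<close>
      moreover have "\<phi> i m x \<noteq> \<phi> i m z"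
        using S[OF I] m n(2) True by (auto simp: last_split_def dest: antisymD)
      ultimately show ?thesis
        using m(1) n(1) True by (auto simp: last_split_def)
    next
      case False
      \<comment> \<open>At the larger index the pair with the smaller splitting index has merged, so
        the relation known for the other pair is the one wanted.\<close>
      have "(\<phi> i (max m n) x, \<phi> i (max m n) z) \<in> S (max m n)"
        using m n False by (cases "m < n") (auto simp: last_split_def max_def)
      then show ?thesis
        using last_split_trans[OF m(1) n(1) False] by blast
    qed
    then show ?thesis using X by (auto simp: last_split_order_def)
  qed
qed

text \<open>The splitting index is unique and symmetric in the two elements, so both comparisons
  happen in the same \<open>S m\<close>, where the images are distinct.\<close>

lemma antisym_last_split_order:
  assumes "\<And>j. j \<in> I \<Longrightarrow> antisym (S j)"
  shows "antisym (last_split_order I X \<phi> S i)"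
proof (rule antisymI, rule ccontr)
  fix x y
  assume "(x, y) \<in> last_split_order I X \<phi> S i" "(y, x) \<in> last_split_order I X \<phi> S i" "x \<noteq> y"
  then obtain m n
    where m: "last_split I X \<phi> i x y m" "(\<phi> i m x, \<phi> i m y) \<in> S m"
      and n: "last_split I X \<phi> i y x n" "(\<phi> i n y, \<phi> i n x) \<in> S n"
    by (auto simp: last_split_order_def)
  have "n = m"
    using last_split_unique m(1) n(1) last_split_commute by metis
  then show False
    using assms[of m] m n(2) by (auto simp: last_split_def dest: antisymD)
qed

theorem proposition16:
  fixes I :: "'i::linorder set"
    and X :: "'i \<Rightarrow> 'a set"
    and le :: "'i \<Rightarrow> 'a rel"
    and \<phi> :: "'i \<Rightarrow> 'i \<Rightarrow> 'a \<Rightarrow> 'a"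
  assumes "persistence_poset I X le \<phi>"
    and "converse_well_founded I"
    and "\<exists>i\<in>I. \<forall>j\<in>I. i < j \<longrightarrow> X j = {}"
  shows "\<exists>L. linear_extension_of I X le \<phi> L"
proof -
  \<comment> \<open>The guard \<open>has_map\<close> is replaced by the stronger condition that the
    target is nonempty, which is what \<open>last_split\<close> provides.\<close>
  have le: "\<And>i. i \<in> I \<Longrightarrow> partial_order_on (X i) (le i)"
    and map: "\<And>i j x. i \<in> I \<Longrightarrow> j \<in> I \<Longrightarrow> i \<le> j \<Longrightarrow> X j \<noteq> {} \<Longrightarrow> x \<in> X i \<Longrightarrow> \<phi> i j x \<in> X j"
    and mono: "\<And>i j x y. i \<in> I \<Longrightarrow> j \<in> I \<Longrightarrow> i \<le> j \<Longrightarrow> X j \<noteq> {} \<Longrightarrow> (x, y) \<in> le i \<Longrightarrow>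
      x \<in> X i \<Longrightarrow> y \<in> X i \<Longrightarrow> (\<phi> i j x, \<phi> i j y) \<in> le j"
    and ident: "\<And>i x. i \<in> I \<Longrightarrow> x \<in> X i \<Longrightarrow> \<phi> i i x = x"
    and comp: "\<And>i j k x. i \<in> I \<Longrightarrow> j \<in> I \<Longrightarrow> k \<in> I \<Longrightarrow> i \<le> j \<Longrightarrow> j \<le> k \<Longrightarrow> X j \<noteq> {} \<Longrightarrow>
      X k \<noteq> {} \<Longrightarrow> x \<in> X i \<Longrightarrow> \<phi> j k (\<phi> i j x) = \<phi> i k x"
    using assms(1)
    unfolding persistence_poset_def has_map_def order_preserving_def monotone_on_def Pi_iff
    by meson+
  obtain S where S: "\<And>i. i \<in> I \<Longrightarrow> linear_order_on (X i) (S i) \<and> le i \<subseteq> S i"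
    using szpilrajn[OF le] by metis
  define L where "L = last_split_order I X \<phi> S"
  have split_ex: "\<exists>m. last_split I X \<phi> i x y m" if "i \<in> I" "x \<in> X i" "y \<in> X i" "x \<noteq> y" for i x y
  proof -
    let ?D = "{j \<in> I. i \<le> j \<and> X j \<noteq> {} \<and> \<phi> i j x \<noteq> \<phi> i j y}"
    \<comment> \<open>Since the map from \<open>i\<close> to itself is the identity, the elements
      are apart at \<open>i\<close>; a maximal element of \<open>?D\<close> is then the last
      split.\<close>
    have "i \<in> ?D" using that ident by auto
    then obtain m where "m \<in> ?D" "\<forall>k\<in>?D. \<not> m < k"
      using assms(2) unfolding converse_well_founded_def
      by (metis (no_types, lifting) empty_iff mem_Collect_eq subsetI)
    then have "last_split I X \<phi> i x y m"
      unfolding last_split_def by (auto dest: le_less_trans)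
    then show ?thesis ..
  qed
  have "le i \<subseteq> L i" if i: "i \<in> I" for i
  proof (rule subrelI)
    fix x y assume xy: "(x, y) \<in> le i"
    then have X: "x \<in> X i" "y \<in> X i" using partial_order_onD(4)[OF le[OF i]] by auto
    show "(x, y) \<in> L i"
    proof (cases "x = y")
      case False
      then obtain m where m: "last_split I X \<phi> i x y m" using split_ex i X by blast
      \<comment> \<open>The given order, unlike \<open>S\<close>, is transported by the structure
        maps, so the pair may be moved to \<open>m\<close> first and enlarged to \<open>S m\<close>
        there.\<close>
      then have "(\<phi> i m x, \<phi> i m y) \<in> le m"
        using mono i X xy unfolding last_split_def by blast
      then have "(\<phi> i m x, \<phi> i m y) \<in> S m"
        using S m unfolding last_split_def by blast
      then show ?thesis
        using m X unfolding L_def last_split_order_def by blast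
    qed (use X in \<open>simp add: L_def last_split_order_def\<close>)
  qed
  moreover have "linear_order_on (X i) (L i)" if i: "i \<in> I" for i
  proof -
    have "trans (L i)" "antisym (L i)"
      unfolding L_def using S
      by (auto intro!: trans_last_split_order antisym_last_split_order simp: order_on_defs)
    moreover have "L i \<subseteq> X i \<times> X i" "refl_on (X i) (L i)"
      by (auto simp: L_def last_split_order_def refl_on_def)
    moreover have "total_on (X i) (L i)"
    proof (rule total_onI)
      fix x y assume xy: "x \<in> X i" "y \<in> X i" "x \<noteq> y"
      then obtain m where m: "last_split I X \<phi> i x y m" using split_ex i by blast
      then have m': "m \<in> I" "X m \<noteq> {}" "i \<le> m" "\<phi> i m x \<noteq> \<phi> i m y"
        unfolding last_split_def by auto
      then have "(\<phi> i m x, \<phi> i m y) \<in> S m \<or> (\<phi> i m y, \<phi> i m x) \<in> S m"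
        using S[OF m'(1)] map[OF i m'(1,3,2)] xy
        unfolding linear_order_on_def total_on_def by blast
      then show "(x, y) \<in> L i \<or> (y, x) \<in> L i"
        using m xy last_split_commute[of I X \<phi> i x y]
        unfolding L_def last_split_order_def by blast
    qed
    ultimately show ?thesis by (simp add: order_on_defs)
  qed
  moreover have "order_preserving (X i) (L i) (L j) (\<phi> i j)"
    if ij: "i \<in> I" "j \<in> I" "i \<le> j" "has_map (X i) (X j)" for i j
    unfolding order_preserving_def
  proof (rule monotone_onI)
    fix x y assume X: "x \<in> X i" "y \<in> X i" and xy: "(x, y) \<in> L i"
    have ne: "X j \<noteq> {}" using X ij(4) by (auto simp: has_map_def)
    have in_Xj: "\<phi> i j x \<in> X j" "\<phi> i j y \<in> X j" using map[OF ij(1-3) ne] X by auto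
    show "(\<phi> i j x, \<phi> i j y) \<in> L j"
    proof (cases "\<phi> i j x = \<phi> i j y")
      case True
      then show ?thesis using in_Xj by (simp add: L_def last_split_order_def)
    next
      case False
      with xy obtain m where m: "last_split I X \<phi> i x y m" "(\<phi> i m x, \<phi> i m y) \<in> S m"
        by (auto simp: L_def last_split_order_def)
      \<comment> \<open>If \<open>m < j\<close>, the images would already agree at \<open>j\<close>,
        contrary to the case assumption.\<close>
      have jm: "j \<le> m"
        using m(1) False ij(2) ne unfolding last_split_def by (metis not_le)
      \<comment> \<open>By functoriality the images of the two elements from \<open>m\<close>
        onwards can be computed through \<open>j\<close>. Hence \<open>m\<close> is also the last
        split of their images in \<open>X j\<close>, and the same pair in \<open>S m\<close> decides
        both comparisons.\<close>
      have eq: "\<phi> j k (\<phi> i j x) = \<phi> i k x" "\<phi> j k (\<phi> i j y) = \<phi> i k y"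
        if "k \<in> I" "X k \<noteq> {}" "m \<le> k" for k
        using comp[OF ij(1,2) that(1) ij(3) _ ne that(2)] X jm that(3) by auto
      have "last_split I X \<phi> j (\<phi> i j x) (\<phi> i j y) m"
        using m(1) jm eq unfolding last_split_def by (metis less_imp_le order_refl)
      moreover have "(\<phi> j m (\<phi> i j x), \<phi> j m (\<phi> i j y)) \<in> S m"
        using m eq unfolding last_split_def by auto
      ultimately show ?thesis
        using in_Xj unfolding L_def last_split_order_def by blast
    qed
  qed
  ultimately have "linear_extension_of I X le \<phi> L"
    unfolding linear_extension_of_def extension_of_def linear_order_on_def by blast
  then show ?thesis by blast
qed

end
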